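(* Let $H$ be any graph. Then $$\operatorname{ex}_{\mathcal P}(n,H,\emptyset)=O\big(n^{\alpha(H)}\big),$$ where the implied constant may depend on $H$.
   Context: All graphs are finite and simple, with at least one vertex. $\operatorname{ex}_{\mathcal P}(n,H,\emptyset)$ denotes the maximum number of copies of $H$ (subgraphs isomorphic to $H$, not necessarily induced) in an $n$-vertex planar graph. $\alpha(H)$ denotes the independence number of $H$, i.e. the maximum size of an independent set of vertices of $H$. *)

theory Defs
  imports "HOL-Analysis.Analysis" "HOL-Library.Landau_Symbols"
begin

type_synonym 'a graph = "'a set \<times> 'a set set"

abbreviation verts :: "'a graph \<Rightarrow> 'a set" where "verts \<equiv> fst"
abbreviation edges :: "'a graph \<Rightarrow> 'a set set" where "edges \<equiv> snd"

definition simple_graph :: "'a graph \<Rightarrow> bool" where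
  "simple_graph G \<longleftrightarrow>
     finite (verts G) \<and> verts G \<noteq> {} \<and> (\<forall>e \<in> edges G. e \<subseteq> verts G \<and> card e = 2)"

definition subgraph :: "'a graph \<Rightarrow> 'a graph \<Rightarrow> bool" where
  "subgraph F G \<longleftrightarrow> simple_graph F \<and> verts F \<subseteq> verts G \<and> edges F \<subseteq> edges G"

definition isomorphic :: "'a graph \<Rightarrow> 'b graph \<Rightarrow> bool" where
  "isomorphic G H \<longleftrightarrow>
     (\<exists>f. bij_betw f (verts G) (verts H) \<and> (\<lambda>e. f ` e) ` edges G = edges H)"

text \<open>A copy is an unlabelled subgraph, so embeddings of \<open>H\<close> that differ by an
  automorphism of \<open>H\<close> give the same copy.\<close>

definition copies :: "'a graph \<Rightarrow> 'b graph \<Rightarrow> 'b graph set" where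
  "copies H G = {F. subgraph F G \<and> isomorphic H F}"

definition independent_set :: "'a graph \<Rightarrow> 'a set \<Rightarrow> bool" where
  "independent_set G S \<longleftrightarrow> S \<subseteq> verts G \<and> (\<forall>e \<in> edges G. \<not> e \<subseteq> S)"

definition independence_number :: "'a graph \<Rightarrow> nat" where
  "independence_number G = Max (card ` {S. independent_set G S})"

text \<open>The plane is \<^typ>\<open>complex\<close>; the edges are drawn as arbitrary (injective, continuous)
  arcs that meet the drawn vertices and each other only in common ends.\<close>

definition plane_drawing :: "'a graph \<Rightarrow> ('a \<Rightarrow> complex) \<Rightarrow> ('a set \<Rightarrow> real \<Rightarrow> complex) \<Rightarrow> bool" where
  "plane_drawing G p \<gamma> \<longleftrightarrow>
     inj_on p (verts G) \<and>
     (\<forall>e \<in> edges G. arc (\<gamma> e) \<and> {pathstart (\<gamma> e), pathfinish (\<gamma> e)} = p ` e \<and>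
        path_image (\<gamma> e) \<inter> p ` verts G = p ` e) \<and>
     (\<forall>e \<in> edges G. \<forall>e' \<in> edges G. e \<noteq> e' \<longrightarrow>
        path_image (\<gamma> e) \<inter> path_image (\<gamma> e') = p ` (e \<inter> e'))"

definition planar :: "'a graph \<Rightarrow> bool" where
  "planar G \<longleftrightarrow> (\<exists>p \<gamma>. plane_drawing G p \<gamma>)"

text \<open>Vertices of the host graphs are taken from \<^typ>\<open>nat\<close>, which represents every finite graph
  up to isomorphism. For \<open>n = 0\<close> there is no host graph and the value is unspecified.\<close>

definition ex_planar :: "nat \<Rightarrow> 'a graph \<Rightarrow> nat" where
  "ex_planar n H =
     Max {card (copies H G) | G :: nat graph. simple_graph G \<and> card (verts G) = n \<and> planar G}"

end

theory Submission
  imports Defs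
begin

text \<open>A subgraph with at least \<open>2\<^sup>9 \<cdot> 33\<close> edges per vertex contains a subdivision of
  \<open>K\<^bsub>3,3\<^esub>\<close>: at the cost of a factor of two in the density, one passes to the neighbours of a
  connected vertex set \<open>U\<close>, so that a path through \<open>U\<close> can later serve as a subdivided edge
  between any two of them. By the Jordan curve theorem and Janiszewski's theorem,
  \<open>K\<^bsub>3,3\<^esub>\<close> cannot be drawn in the plane, so planar graphs are degenerate. Orient a degenerate
  graph so that in-degrees are bounded. In a copy of \<open>H\<close> the sources form an independent set, and all
  other vertices are found from the sources by a bounded number of choices.\<close>

section \<open>Nonplanarity of \<open>K\<^bsub>3,3\<^esub>\<close>\<close>

text \<open>\<open>D\<close> is the side of the Jordan curve away from \<open>c\<close>. The two
  sides are disjoint open sets, so no connected set off the curve joins them.\<close>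

lemma Jordan_other_side:
  assumes "simple_path J" "pathfinish J = pathstart J" "c \<notin> path_image J"
  obtains D where "D \<noteq> {}" "connected D" "D \<inter> path_image J = {}" "frontier D = path_image J"
    "\<And>q. q \<in> D \<Longrightarrow> \<not> connected_component (- path_image J) q (c::complex)"
proof -
  obtain A B where AB: "A \<noteq> {}" "open A" "connected A" "B \<noteq> {}" "open B" "connected B"
      "A \<inter> B = {}" "A \<union> B = - path_image J" "frontier A = path_image J" "frontier B = path_image J"
    using Jordan_curve[OF assms(1,2)] by metis
  have sep: "\<not> connected_component (- path_image J) q c"
    if XY: "open X" "open Y" "X \<inter> Y = {}" "X \<union> Y = - path_image J" "q \<in> X" "c \<in> Y" for X Y q
  proof
    assume "connected_component (- path_image J) q c"
    then obtain C where C: "connected C" "C \<subseteq> X \<union> Y" "q \<in> C" "c \<in> C"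
      unfolding connected_component_def XY(4)[symmetric] by blast
    then show False
      using connectedD[OF C(1) XY(1,2)] XY C by auto
  qed
  have "c \<in> A \<or> c \<in> B" using AB assms(3) by blast
  then show ?thesis
  proof
    assume "c \<in> A"
    then show ?thesis
      using AB sep[of B A] that[of B] by (metis Int_commute Un_commute disjoint_eq_subset_Compl le_sup_iff order_refl)
  next
    assume "c \<in> B"
    then show ?thesis
      using AB sep[of A B] that[of A] by (metis Un_commute disjoint_eq_subset_Compl le_sup_iff order_refl)
  qed
qed

text \<open>Two of the paths form a Jordan curve; let \<open>q\<close> lie on its side
  \<open>D\<close> away from \<open>c\<close>. One can get from \<open>q\<close> to \<open>c\<close>
  avoiding \<open>P y\<close> and \<open>P z\<close>, and also avoiding \<open>P x\<close> and
  \<open>P z\<close>. These two obstacles meet in the connected set \<open>P z\<close>, so by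
  Janiszewski their union does not separate \<open>q\<close> from \<open>c\<close> either, and hence
  neither does the curve.\<close>

lemma no_star_over_theta:
  fixes P :: "'i \<Rightarrow> real \<Rightarrow> complex"
  assumes I: "card I = 3"
    and P: "\<And>i. i \<in> I \<Longrightarrow> arc (P i) \<and> pathstart (P i) = a \<and> pathfinish (P i) = b"
    and PP: "\<And>i j. i \<in> I \<Longrightarrow> j \<in> I \<Longrightarrow> i \<noteq> j \<Longrightarrow> path_image (P i) \<inter> path_image (P j) \<subseteq> {a, b}"
    and T: "\<And>i. i \<in> I \<Longrightarrow> connected (T i) \<and> c \<in> T i \<and> w i \<in> T i \<inter> path_image (P i) - {a, b}"
    and TP: "\<And>i j. i \<in> I \<Longrightarrow> j \<in> I \<Longrightarrow> i \<noteq> j \<Longrightarrow> T i \<inter> path_image (P j) = {}"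
  shows False
proof -
  obtain x y z where xyz: "I = {x, y, z}" "x \<noteq> y" "y \<noteq> z" "x \<noteq> z"
    using I by (auto simp: card_3_iff)
  let ?I = "\<lambda>i. path_image (P i)"
  have ab: "a \<in> ?I i" "b \<in> ?I i" if "i \<in> I" for i
    using P[OF that] by (metis pathstart_in_path_image, metis pathfinish_in_path_image)
  define J where "J = P x +++ reversepath (P y)"
  have J: "path_image J = ?I x \<union> ?I y"
    unfolding J_def using P xyz by (subst path_image_join) auto
  have "simple_path J"
    unfolding J_def using P[of x] P[of y] PP[of x y] xyz
    by (intro simple_path_join_loop) (auto simp: arc_reversepath)
  moreover have "pathfinish J = pathstart J"
    unfolding J_def using P xyz by auto
  moreover have c: "c \<notin> ?I i" if "i \<in> I" for i
  proof -
    obtain j where "j \<in> I" "j \<noteq> i" using xyz by blast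
    then show ?thesis using T[of j] TP[of j i] that by blast
  qed
  ultimately obtain D where D: "D \<noteq> {}" "connected D" "D \<inter> path_image J = {}"
      "frontier D = path_image J"
      "\<And>q. q \<in> D \<Longrightarrow> \<not> connected_component (- path_image J) q c"
    using Jordan_other_side[of J c] J xyz by blast
  \<comment> \<open>A point of \<open>D\<close> on the third path could be joined to
    \<open>c\<close> along that path and then \<open>T z\<close> without touching the curve.\<close>
  have Dz: "D \<inter> ?I z = {}"
  proof (rule ccontr)
    assume "D \<inter> ?I z \<noteq> {}"
    then obtain q where q: "q \<in> D" "q \<in> ?I z" by blast
    then have qab: "q \<notin> {a, b}" using D(3) J ab xyz by blast
    define C where "C = (?I z - {a, b}) \<union> T z"
    have "connected (?I z - {a, b})"
      using connected_simple_path_endless[of "P z"] P[of z] xyz by (auto intro: arc_imp_simple_path)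
    then have "connected C"
      unfolding C_def using T[of z] xyz by (intro connected_Un) auto
    moreover have "C \<inter> path_image J = {}"
      unfolding C_def J using PP[of z x] PP[of z y] TP[of z x] TP[of z y] xyz by auto
    moreover have "q \<in> C" "c \<in> C" using q qab T[of z] xyz by (auto simp: C_def)
    ultimately have "connected_component (- path_image J) q c"
      unfolding connected_component_def by blast
    then show False using D(5) q by blast
  qed
  obtain q where q: "q \<in> D" using D(1) by blast
  \<comment> \<open>Leave \<open>D\<close> through the frontier point \<open>w i\<close> and follow
    \<open>T i\<close> to \<open>c\<close>: of the three paths, only \<open>P i\<close> can be
    met.\<close>
  have conn: "connected_component (- (?I j \<union> ?I z)) q c" if ij: "{i, j} = {x, y}" "i \<noteq> j" for i j
  proof -
    have iI: "i \<in> I" "j \<in> I" "i \<noteq> z" "j \<noteq> z" using ij xyz by (auto simp: doubleton_eq_iff)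
    have wi: "w i \<in> T i" "w i \<in> ?I i" "w i \<notin> {a, b}" using T[OF iI(1)] by auto
    have Jij: "path_image J = ?I i \<union> ?I j" using J ij by (auto simp: doubleton_eq_iff)
    have "w i \<in> closure D"
      using D(4) wi Jij by (auto simp: frontier_def)
    then have "connected (insert (w i) D)"
      using connected_intermediate_closure[OF D(2), of "insert (w i) D"] closure_subset by blast
    then have "connected (insert (w i) D \<union> T i)"
      using T[OF iI(1)] wi by (intro connected_Un) auto
    moreover have "(insert (w i) D \<union> T i) \<inter> (?I j \<union> ?I z) = {}"
      using D(3) Dz Jij PP[of i j] PP[of i z] TP[of i j] TP[of i z] wi iI xyz ij(2) by blast
    ultimately show ?thesis
      unfolding connected_component_def using q T[OF iI(1)]
      by (intro exI[of _ "insert (w i) D \<union> T i"]) auto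
  qed
  \<comment> \<open>\<open>P x\<close> and \<open>P y\<close> meet only in \<open>a\<close> and
    \<open>b\<close>, which lie on \<open>P z\<close> as well.\<close>
  have int: "(?I x \<union> ?I z) \<inter> (?I y \<union> ?I z) = ?I z"
    using PP[of x y] ab[of z] xyz by blast
  have arcs: "arc (P x)" "arc (P y)" "arc (P z)" using P xyz by auto
  have "connected_component (- ((?I x \<union> ?I z) \<union> (?I y \<union> ?I z))) q c"
  proof (rule Janiszewski)
    show "connected ((?I x \<union> ?I z) \<inter> (?I y \<union> ?I z))"
      unfolding int using arcs by (simp add: connected_arc_image)
    show "connected_component (- (?I x \<union> ?I z)) q c" using conn[of y x] xyz by auto
    show "connected_component (- (?I y \<union> ?I z)) q c" using conn[of x y] xyz by auto
  qed (use arcs in \<open>auto intro!: compact_Un closed_Un simp: compact_arc_image closed_arc_image\<close>)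
  then have "connected_component (- path_image J) q c"
    unfolding J by (rule connected_component_of_subset) auto
  then show False using D(5) q by blast
qed

text \<open>Two of the vertices on the one side span a theta graph with the three on the other side;
  the third one is the centre of a star over it.\<close>

lemma no_K33_arcs:
  fixes v :: "nat \<Rightarrow> complex" and g :: "nat \<times> nat \<Rightarrow> real \<Rightarrow> complex"
  assumes inj: "inj_on v {..<6}"
    and arc: "\<And>i j. i \<in> {0,1,2} \<Longrightarrow> j \<in> {3,4,5} \<Longrightarrow>
      arc (g (i, j)) \<and> pathstart (g (i, j)) = v i \<and> pathfinish (g (i, j)) = v j
        \<and> path_image (g (i, j)) \<inter> v ` {..<6} \<subseteq> {v i, v j}"
    and disj: "\<And>i j k l. i \<in> {0,1,2} \<Longrightarrow> j \<in> {3,4,5} \<Longrightarrow> k \<in> {0,1,2} \<Longrightarrow> l \<in> {3,4,5} \<Longrightarrow>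
      (i, j) \<noteq> (k, l) \<Longrightarrow>
      path_image (g (i, j)) \<inter> path_image (g (k, l)) \<subseteq> {v i, v j} \<inter> {v k, v l}"
  shows False
proof -
  define P where "P j = g (0, j) +++ reversepath (g (1, j))" for j
  have v: "v i = v j \<longleftrightarrow> i = j" if "i < 6" "j < 6" for i j
    using inj that by (auto simp: inj_on_def)
  have P: "path_image (P j) = path_image (g (0, j)) \<union> path_image (g (1, j))" if "j \<in> {3,4,5}" for j
    unfolding P_def using arc[of 0 j] arc[of 1 j] that by (subst path_image_join) auto
  have ends: "v i \<in> path_image (g (i, j))" "v j \<in> path_image (g (i, j))"
    if "i \<in> {0,1,2}" "j \<in> {3,4,5}" for i j
    using arc[OF that] by (metis pathstart_in_path_image, metis pathfinish_in_path_image)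
  show False
  \<comment> \<open>The arc from \<open>v 2\<close> reaches \<open>P j\<close> at
    \<open>v j\<close>, where the two arcs forming \<open>P j\<close> are joined.\<close>
  proof (rule no_star_over_theta[where I = "{3,4,5}" and P = P and a = "v 0" and b = "v 1"
        and T = "\<lambda>j. path_image (g (2, j))" and c = "v 2" and w = v])
    show "card {3, 4, 5::nat} = 3" by simp
  next
    fix j :: nat assume j: "j \<in> {3,4,5}"
    have "path_image (g (0, j)) \<inter> path_image (g (1, j)) \<subseteq> {v j}"
      using disj[of 0 j 1 j] j v by auto
    then show "arc (P j) \<and> pathstart (P j) = v 0 \<and> pathfinish (P j) = v 1"
      unfolding P_def using arc[of 0 j] arc[of 1 j] j
      by (auto intro!: arc_join simp: arc_reversepath)
  next
    fix j k :: nat assume jk: "j \<in> {3,4,5}" "k \<in> {3,4,5}" "j \<noteq> k"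
    show "path_image (P j) \<inter> path_image (P k) \<subseteq> {v 0, v 1}"
      unfolding P[OF jk(1)] P[OF jk(2)]
      using disj[of 0 j 0 k] disj[of 0 j 1 k] disj[of 1 j 0 k] disj[of 1 j 1 k] jk v[of j k]
      by auto
    have jk6: "j < 6" "k < 6" "j > 2" "k > 2" using jk by auto
    have "path_image (g (2, j)) \<inter> path_image (g (i, k)) = {}" if "i \<in> {0,1}" for i
    proof -
      have "v 2 \<noteq> v i" "v 2 \<noteq> v k" "v j \<noteq> v i" "v j \<noteq> v k"
        using jk(3) jk6 that v by auto
      moreover have "path_image (g (2, j)) \<inter> path_image (g (i, k)) \<subseteq> {v 2, v j} \<inter> {v i, v k}"
        using jk(1,2) that by (intro disj) auto
      ultimately show ?thesis by blast
    qed
    then show "path_image (g (2, j)) \<inter> path_image (P k) = {}"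
      unfolding P[OF jk(2)] by blast
  next
    fix j :: nat assume j: "j \<in> {3,4,5}"
    then have "v j \<noteq> v 0" "v j \<noteq> v 1" using v by auto
    then show "connected (path_image (g (2, j))) \<and> v 2 \<in> path_image (g (2, j)) \<and>
        v j \<in> path_image (g (2, j)) \<inter> path_image (P j) - {v 0, v 1}"
      using arc[of 2 j] ends[of 2 j] ends[of 0 j] P[OF j] j by (auto simp: connected_arc_image)
  qed
qed

section \<open>Dense graphs and degeneracy\<close>

definition edges_in :: "'v set set \<Rightarrow> 'v set \<Rightarrow> 'v set set" where
  "edges_in E S = {e \<in> E. e \<subseteq> S}"

definition nbrs :: "'v set set \<Rightarrow> 'v set \<Rightarrow> 'v \<Rightarrow> 'v set" where
  "nbrs E S x = {y \<in> S. {x, y} \<in> E}"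

text \<open>Growth by one vertex at a time suits both the contraction argument and the induction
  that shows the drawing of such a set to be path-connected.\<close>

inductive connected_verts :: "'v set set \<Rightarrow> 'v set \<Rightarrow> bool" for E where
  single: "connected_verts E {v}"
| step: "connected_verts E U \<Longrightarrow> u \<in> U \<Longrightarrow> {u, x} \<in> E \<Longrightarrow> connected_verts E (insert x U)"

section \<open>Degrees and edge counts\<close>

lemma finite_edges_in [simp]: "finite S \<Longrightarrow> finite (edges_in E S)"
  by (rule finite_subset[of _ "Pow S"]) (auto simp: edges_in_def)

lemma finite_nbrs [simp]: "finite S \<Longrightarrow> finite (nbrs E S x)"
  by (auto simp: nbrs_def)

lemma card_nbrs:
  assumes E: "\<forall>e \<in> E. card e = 2" and "x \<in> S"
  shows "card (nbrs E S x) = card {e \<in> edges_in E S. x \<in> e}"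
proof -
  have "bij_betw (\<lambda>y. {x, y}) (nbrs E S x) {e \<in> edges_in E S. x \<in> e}"
  proof (rule bij_betw_imageI)
    show "inj_on (\<lambda>y. {x, y}) (nbrs E S x)" by (auto simp: inj_on_def doubleton_eq_iff)
    show "(\<lambda>y. {x, y}) ` nbrs E S x = {e \<in> edges_in E S. x \<in> e}"
    proof
      show "(\<lambda>y. {x, y}) ` nbrs E S x \<subseteq> {e \<in> edges_in E S. x \<in> e}"
        using assms by (auto simp: nbrs_def edges_in_def)
      show "{e \<in> edges_in E S. x \<in> e} \<subseteq> (\<lambda>y. {x, y}) ` nbrs E S x"
      proof
        fix e assume e: "e \<in> {e \<in> edges_in E S. x \<in> e}"
        then obtain a b where "e = {a, b}" using E by (auto simp: edges_in_def card_2_iff)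
        then obtain y where y: "e = {x, y}" using e by auto
        then have "y \<in> nbrs E S x" using e by (auto simp: nbrs_def edges_in_def)
        then show "e \<in> (\<lambda>y. {x, y}) ` nbrs E S x" using y by blast
      qed
    qed
  qed
  then show ?thesis by (rule bij_betw_same_card)
qed

lemma handshake:
  assumes E: "\<forall>e \<in> E. card e = 2" and S: "finite S"
  shows "(\<Sum>x\<in>S. card (nbrs E S x)) = 2 * card (edges_in E S)"
proof -
  have "(\<Sum>x\<in>S. card {e \<in> edges_in E S. x \<in> e}) = 2 * card (edges_in E S)"
  proof (rule sum_multicount)
    show "\<forall>e\<in>edges_in E S. card {x \<in> S. x \<in> e} = 2"
    proof
      fix e assume "e \<in> edges_in E S"
      then have "{x \<in> S. x \<in> e} = e" "card e = 2" using E by (auto simp: edges_in_def)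
      then show "card {x \<in> S. x \<in> e} = 2" by simp
    qed
  qed (use S in auto)
  then show ?thesis using card_nbrs[OF E] by simp
qed

text \<open>The degree sum counts each edge twice. This is where a factor of two is lost in passing
  from degrees back to edges per vertex.\<close>

lemma min_degree_edges:
  assumes "\<forall>e \<in> E. card e = 2" "finite S" "\<And>x. x \<in> S \<Longrightarrow> 2 * L \<le> card (nbrs E S x)"
  shows "L * card S \<le> card (edges_in E S)"
  using sum_bounded_below[of S "2 * L" "\<lambda>x. card (nbrs E S x)"] assms(3) handshake[OF assms(1,2)]
  by (simp add: mult.commute)

lemma card_edges_in_remove:
  assumes E: "\<forall>e \<in> E. card e = 2" and "finite S" "x \<in> S"
  shows "card (edges_in E S) = card (edges_in E (S - {x})) + card (nbrs E S x)"
proof -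
  have "edges_in E S = edges_in E (S - {x}) \<union> {e \<in> edges_in E S. x \<in> e}"
    by (auto simp: edges_in_def)
  moreover have "edges_in E (S - {x}) \<inter> {e \<in> edges_in E S. x \<in> e} = {}"
    by (auto simp: edges_in_def)
  ultimately show ?thesis
    using card_Un_disjoint[of "edges_in E (S - {x})" "{e \<in> edges_in E S. x \<in> e}"]
      card_nbrs[OF E assms(3)] assms(2) by simp
qed

text \<open>Inside a smallest dense vertex set \<open>S\<close>, contract a maximal connected set \<open>U\<close> such that the
  contracted graph is still dense: contracting a neighbour \<open>w\<close> of \<open>U\<close> as well would lose one vertex,
  the edge from \<open>w\<close> to \<open>U\<close>, and one edge for each common neighbour of \<open>w\<close> and \<open>U\<close>.\<close>

lemma dense_neighbourhood_of_connected:
  assumes E: "\<forall>e \<in> E. card e = 2" and fin: "finite S" and "S \<noteq> {}" and "0 < L"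
    and dense: "L * card S \<le> card (edges_in E S)"
  obtains U W where "connected_verts E U" "U \<subseteq> S" "W \<subseteq> S" "U \<inter> W = {}" "W \<noteq> {}"
    "\<And>w. w \<in> W \<Longrightarrow> \<exists>u\<in>U. {u, w} \<in> E" "\<And>w. w \<in> W \<Longrightarrow> L \<le> card (nbrs E W w)"
proof -
  have loop: "{x} \<notin> E" for x using E by force
  define dense where "dense S' \<longleftrightarrow> S' \<subseteq> S \<and> S' \<noteq> {} \<and> L * card S' \<le> card (edges_in E S')" for S'
  have "dense S" using assms by (simp add: dense_def)
  then obtain T where T: "dense T" and Tmin: "\<And>T'. dense T' \<Longrightarrow> card T \<le> card T'"
    using ex_has_least_nat[of dense S card] by metis
  have TS: "T \<subseteq> S" "finite T" "T \<noteq> {}" "L * card T \<le> card (edges_in E T)"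
    using T fin finite_subset by (auto simp: dense_def)
  define N where "N U = {w \<in> T - U. \<exists>u\<in>U. {u, w} \<in> E}" for U
  \<comment> \<open>This is density of \<open>T\<close> with \<open>U\<close> contracted:
    \<open>+ 1\<close> stands for the contracted vertex, which has a single edge to each vertex of
    \<open>N U\<close> because parallel edges are merged.\<close>
  define Q where "Q U \<longleftrightarrow> connected_verts E U \<and> U \<subseteq> T \<and>
    L * (card (T - U) + 1) \<le> card (edges_in E (T - U)) + card (N U)" for U
  obtain v where v: "v \<in> T" using TS by blast
  \<comment> \<open>Contracting a single vertex changes nothing, so \<open>Q {v}\<close> is just the
    density of \<open>T\<close>.\<close>
  have "N {v} = nbrs E T v" using loop by (auto simp: N_def nbrs_def)
  then have "Q {v}"
    using card_edges_in_remove[OF E TS(2) v] TS v card_Suc_Diff1[OF TS(2) v]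
    by (auto simp: Q_def connected_verts.single)
  moreover have bound: "\<forall>U. Q U \<longrightarrow> card U < Suc (card T)"
    using TS(2) by (auto simp: Q_def intro: card_mono less_Suc_eq_le[THEN iffD2])
  ultimately obtain U where U: "Q U" and Umax: "\<And>U'. Q U' \<Longrightarrow> card U' \<le> card U"
    using ex_has_greatest_nat[of Q "{v}" card] by metis
  have UT: "connected_verts E U" "U \<subseteq> T"
    "L * (card (T - U) + 1) \<le> card (edges_in E (T - U)) + card (N U)"
    using U by (auto simp: Q_def)
  have finU: "finite U" and finN: "finite (N U)"
    using UT TS(2) finite_subset by (auto simp: N_def)
  have "U \<noteq> {}" using UT(1) by cases auto
  show ?thesis
  proof (rule that[OF UT(1), of "N U"])
    show "N U \<noteq> {}"
    proof
      \<comment> \<open>Without neighbours of \<open>U\<close>, the rest \<open>T - U\<close> would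
        be a smaller dense set. It is nonempty, since the contracted vertex alone would need
        \<open>L\<close> edges.\<close>
      assume N: "N U = {}"
      have "T - U \<noteq> {}"
      proof
        assume empty: "T - U = {}"
        have "edges_in E (T - U) = {}" unfolding empty using E by (auto simp: edges_in_def)
        then show False using UT(3) N \<open>0 < L\<close> by simp
      qed
      then have "dense (T - U)" using UT(3) N TS(1) by (auto simp: dense_def)
      then have "card T \<le> card (T - U)" by (rule Tmin)
      moreover have "card (T - U) < card T"
        using \<open>U \<noteq> {}\<close> UT(2) TS(2) by (intro psubset_card_mono) auto
      ultimately show False by simp
    qed
  next
    fix w assume w: "w \<in> N U"
    then obtain u where u: "u \<in> U" "{u, w} \<in> E" and wT: "w \<in> T - U" by (auto simp: N_def)
    show "L \<le> card (nbrs E (N U) w)"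
    proof (rule ccontr)
      assume less: "\<not> L \<le> card (nbrs E (N U) w)"
      let ?U = "insert w U"
      let ?A = "nbrs E (T - U) w"
      have diff: "T - ?U = T - U - {w}" by blast
      have cT: "card (T - U) = card (T - ?U) + 1"
        using wT TS(2) card_Suc_Diff1[of "T - U" w] by (simp add: diff)
      have e: "card (edges_in E (T - U)) = card (edges_in E (T - ?U)) + card ?A"
        unfolding diff using card_edges_in_remove[OF E _ wT] TS(2) by simp
      \<comment> \<open>Absorbing \<open>w\<close> removes it from the neighbourhood and brings in
        those neighbours of \<open>w\<close> that were not yet adjacent to \<open>U\<close>.\<close>
      have "N ?U = (N U - {w}) \<union> (?A - nbrs E (N U) w)"
        using loop wT by (auto simp: N_def nbrs_def)
      moreover have "(N U - {w}) \<inter> (?A - nbrs E (N U) w) = {}" by (auto simp: nbrs_def)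
      moreover have "nbrs E (N U) w \<subseteq> ?A" by (auto simp: nbrs_def N_def)
      ultimately have "card (N ?U) = (card (N U) - 1) + (card ?A - card (nbrs E (N U) w))"
        using w finN TS(2) by (simp add: card_Un_disjoint card_Diff_subset)
      moreover have "card (nbrs E (N U) w) \<le> card ?A"
        using TS(2) by (intro card_mono) (auto simp: nbrs_def N_def)
      moreover have "card (N U) > 0" using w finN by (auto simp: card_gt_0_iff)
      ultimately have cN: "card (N ?U) + 1 + card (nbrs E (N U) w) = card (N U) + card ?A"
        by linarith
      have "L * (card (T - ?U) + 1) + L \<le> card (edges_in E (T - U)) + card (N U)"
        using UT(3) cT by (simp add: algebra_simps)
      \<comment> \<open>One edge for \<open>w\<close> and fewer than \<open>L\<close> for common
        neighbours are lost, so at most \<open>L\<close> edges against one vertex: \<open>U\<close>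
        was not maximal.\<close>
      then have "L * (card (T - ?U) + 1) \<le> card (edges_in E (T - ?U)) + card (N ?U)"
        using e cN less by linarith
      then have "Q ?U"
        using connected_verts.step[OF UT(1) u] UT(2) wT by (auto simp: Q_def)
      then show False using Umax[of ?U] wT finU by simp
    qed
  qed (use UT(2) TS(1) in \<open>auto simp: N_def\<close>)
qed

text \<open>A vertex of degree below \<open>D\<close> is ranked on top and the rest by induction;
  the lower neighbours of the other vertices stay the same.\<close>

lemma degeneracy_ranking:
  assumes "finite V" "\<And>S. S \<subseteq> V \<Longrightarrow> S \<noteq> {} \<Longrightarrow> \<exists>x\<in>S. card (nbrs E S x) < D"
  shows "\<exists>r :: 'v \<Rightarrow> nat. inj_on r V \<and> r ` V \<subseteq> {..<card V} \<and>
    (\<forall>v\<in>V. card {u \<in> V. {u, v} \<in> E \<and> r u < r v} < D)"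
  using assms
proof (induction V rule: finite_psubset_induct)
  case (psubset V)
  show ?case
  proof (cases "V = {}")
    case False
    then obtain x where x: "x \<in> V" "card (nbrs E V x) < D" using psubset.prems by blast
    have "V - {x} \<subset> V" using x by blast
    moreover have "\<exists>y\<in>S. card (nbrs E S y) < D" if "S \<subseteq> V - {x}" "S \<noteq> {}" for S
      using psubset.prems[of S] that by blast
    ultimately obtain r where r: "inj_on r (V - {x})" "r ` (V - {x}) \<subseteq> {..<card (V - {x})}"
      "\<forall>v\<in>V - {x}. card {u \<in> V - {x}. {u, v} \<in> E \<and> r u < r v} < D"
      using psubset.IH[of "V - {x}"] by blast
    define s where "s = r(x := card (V - {x}))"
    have sx: "s x = card (V - {x})" and s: "\<And>u. u \<in> V - {x} \<Longrightarrow> s u = r u"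
      by (auto simp: s_def)
    have lt: "s u < s x" if "u \<in> V - {x}" for u using r(2) s[OF that] sx that by auto
    have cV: "card V = Suc (card (V - {x}))"
      using card_Suc_Diff1[OF psubset.hyps x(1)] by simp
    have "inj_on s V"
    proof (rule inj_onI)
      fix u w assume *: "u \<in> V" "w \<in> V" "s u = s w"
      show "u = w"
      proof (cases "u = x \<or> w = x")
        case True then show ?thesis using * lt by (metis Diff_iff less_irrefl singletonD)
      next
        case False then show ?thesis using * s r(1) by (auto simp: inj_on_def)
      qed
    qed
    moreover have "s ` V \<subseteq> {..<card V}"
    proof
      fix k assume "k \<in> s ` V"
      then obtain u where "u \<in> V" "k = s u" by blast
      then have "k \<le> s x" using lt[of u] by (cases "u = x") auto
      then show "k \<in> {..<card V}" unfolding cV sx by simp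
    qed
    moreover have "card {u \<in> V. {u, v} \<in> E \<and> s u < s v} < D" if v: "v \<in> V" for v
    proof (cases "v = x")
      case True
      have "card {u \<in> V. {u, x} \<in> E \<and> s u < s x} \<le> card (nbrs E V x)"
        using psubset.hyps by (intro card_mono) (auto simp: nbrs_def insert_commute)
      then show ?thesis using x(2) True by simp
    next
      case False
      then have vx: "v \<in> V - {x}" using v by blast
      have "{u \<in> V. {u, v} \<in> E \<and> s u < s v} = {u \<in> V - {x}. {u, v} \<in> E \<and> r u < r v}"
      proof (intro Collect_cong)
        fix u
        show "u \<in> V \<and> {u, v} \<in> E \<and> s u < s v \<longleftrightarrow> u \<in> V - {x} \<and> {u, v} \<in> E \<and> r u < r v"
          using lt[OF vx] s[OF vx] s[of u] by (cases "u = x") auto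
      qed
      then show ?thesis using r(3) vx by simp
    qed
    ultimately show ?thesis by blast
  qed simp
qed

section \<open>Plane drawings of dense graphs\<close>

locale drawn_graph =
  fixes V :: "'v set" and E :: "'v set set" and p :: "'v \<Rightarrow> complex"
    and \<gamma> :: "'v set \<Rightarrow> real \<Rightarrow> complex"
  assumes graph: "simple_graph (V, E)" and drawing: "plane_drawing (V, E) p \<gamma>"
begin

lemma finite_V: "finite V"
  and card_edge: "\<forall>e\<in>E. card e = 2"
  and edge_subset: "e \<in> E \<Longrightarrow> e \<subseteq> V"
  using graph by (auto simp: simple_graph_def)

lemma inj_p: "inj_on p V"
  and arc_edge: "e \<in> E \<Longrightarrow> arc (\<gamma> e)"
  and edge_verts: "e \<in> E \<Longrightarrow> path_image (\<gamma> e) \<inter> p ` V = p ` e"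
  and edge_edge: "e \<in> E \<Longrightarrow> e' \<in> E \<Longrightarrow> e \<noteq> e' \<Longrightarrow> path_image (\<gamma> e) \<inter> path_image (\<gamma> e') = p ` (e \<inter> e')"
  using drawing by (auto simp: plane_drawing_def)

section \<open>Drawings of induced subgraphs\<close>

definition region :: "'v set \<Rightarrow> complex set" where
  "region S = p ` S \<union> (\<Union>e\<in>edges_in E S. path_image (\<gamma> e))"

lemma region_mono: "S \<subseteq> T \<Longrightarrow> region S \<subseteq> region T"
  by (auto simp: region_def edges_in_def)

lemma edge_ends: "e \<in> E \<Longrightarrow> x \<in> e \<Longrightarrow> p x \<in> path_image (\<gamma> e)"
  using edge_verts by blast

lemma path_connected_edge: "e \<in> E \<Longrightarrow> path_connected (path_image (\<gamma> e))"
  using arc_edge arc_imp_path by (blast intro: path_connected_path_image)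

text \<open>The edges gained with a new vertex \<open>x\<close> form a star through
  \<open>p x\<close>, attached to the earlier region at \<open>p u\<close>.\<close>

lemma path_connected_region: "connected_verts E U \<Longrightarrow> path_connected (region U)"
proof (induction rule: connected_verts.induct)
  case (single v)
  have "edges_in E {v} = {}"
    using card_edge by (auto simp: edges_in_def subset_singleton_iff)
  then show ?case by (simp add: region_def)
next
  case (step U u x)
  show ?case
  proof (cases "x \<in> U")
    case True then show ?thesis using step by (simp add: insert_absorb)
  next
    case False
    let ?F = "{e \<in> edges_in E (insert x U). x \<in> e}"
    let ?R = "\<Union>e\<in>?F. path_image (\<gamma> e)"
    have ux: "{u, x} \<in> ?F" using step by (auto simp: edges_in_def)
    have "path_connected ?R"
    proof (rule path_connected_UNION)
      show "path_connected (path_image (\<gamma> e))" if "e \<in> ?F" for e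
        using that path_connected_edge by (auto simp: edges_in_def)
      show "p x \<in> path_image (\<gamma> e)" if "e \<in> ?F" for e
        using that edge_ends by (auto simp: edges_in_def)
    qed
    moreover have "p u \<in> ?R" "p x \<in> ?R"
      using ux edge_ends[OF step.hyps(3)] by blast+
    moreover have "region (insert x U) = region U \<union> ?R"
    proof -
      have eq: "edges_in E (insert x U) = edges_in E U \<union> ?F" by (auto simp: edges_in_def)
      have "region (insert x U) = p ` insert x U \<union> (\<Union>e\<in>edges_in E U \<union> ?F. path_image (\<gamma> e))"
        by (simp only: region_def eq[symmetric])
      also have "\<dots> = region U \<union> ?R"
        using \<open>p x \<in> ?R\<close> unfolding region_def by blast
      finally show ?thesis .
    qed
    moreover have "p u \<in> region U" using step.hyps by (simp add: region_def)
    ultimately show ?thesis using step.IH by (auto intro!: path_connected_Un)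
  qed
qed

text \<open>Such an edge differs from every edge drawn in \<open>region W\<close>, so it meets these
  only in common ends.\<close>

lemma edge_region:
  assumes "e \<in> E" "W \<subseteq> V" "\<not> e \<subseteq> W"
  shows "path_image (\<gamma> e) \<inter> region W \<subseteq> p ` (e \<inter> W)"
proof
  fix z assume z: "z \<in> path_image (\<gamma> e) \<inter> region W"
  then consider w where "w \<in> W" "z = p w" | e' where "e' \<in> edges_in E W" "z \<in> path_image (\<gamma> e')"
    by (auto simp: region_def)
  then show "z \<in> p ` (e \<inter> W)"
  proof cases
    case 1
    then have "z \<in> p ` e" using z edge_verts[OF assms(1)] assms(2) by blast
    then show ?thesis
      using 1 inj_p edge_subset[OF assms(1)] assms(2) by (auto simp: inj_on_def)
  next
    case 2
    then have "e' \<in> E" "e' \<subseteq> W" "e' \<noteq> e" using assms by (auto simp: edges_in_def)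
    then show ?thesis using edge_edge[of e e'] assms(1) z 2 by blast
  qed
qed

text \<open>An edge inside \<open>U\<close> has no end in \<open>W\<close>, and a drawn vertex lies
  only on edges that contain it.\<close>

lemma disjoint_regions:
  assumes "U \<subseteq> V" "W \<subseteq> V" "U \<inter> W = {}"
  shows "region U \<inter> region W = {}"
proof -
  have "path_image (\<gamma> e) \<inter> region W = {}" if "e \<in> edges_in E U" for e
  proof -
    have e: "e \<in> E" "e \<subseteq> U" using that by (auto simp: edges_in_def)
    then have "e \<noteq> {}" using card_edge by force
    then show ?thesis using edge_region[of e W] e assms by blast
  qed
  moreover have "p u \<notin> region W" if "u \<in> U" for u
  proof
    assume "p u \<in> region W"
    then consider w where "w \<in> W" "p u = p w" | e where "e \<in> edges_in E W" "p u \<in> path_image (\<gamma> e)"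
      by (auto simp: region_def)
    then show False
    proof cases
      case 1 then show False using inj_p assms that by (metis IntI empty_iff inj_onD subsetD)
    next
      case 2
      then have e: "e \<in> E" "e \<subseteq> W" by (auto simp: edges_in_def)
      then have "p u \<in> p ` e" using edge_verts[OF e(1)] 2 that assms(1) by blast
      then obtain w where "w \<in> e" "p u = p w" by blast
      then have "u = w" using inj_p assms that e by (meson inj_onD subsetD)
      then show False using \<open>w \<in> e\<close> e that assms by blast
    qed
  qed
  ultimately show ?thesis unfolding region_def[of U] by blast
qed

text \<open>This provides a subdivided edge from \<open>x\<close> to \<open>y\<close>: an edge into
  \<open>U\<close>, a path in the region of \<open>U\<close>, and an edge out again. Both edges have
  just one end in \<open>W\<close>, and the regions of \<open>U\<close> and \<open>W\<close> are
  disjoint.\<close>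

lemma arc_through_connected:
  assumes U: "connected_verts E U" and sub: "U \<subseteq> V" "W \<subseteq> V" "U \<inter> W = {}"
    and x: "x \<in> W" "u \<in> U" "{u, x} \<in> E" and y: "y \<in> W" "w \<in> U" "{w, y} \<in> E" and "x \<noteq> y"
  obtains h where "arc h" "pathstart h = p x" "pathfinish h = p y"
    "path_image h \<subseteq> region (U \<union> W)" "path_image h \<inter> region W \<subseteq> {p x, p y}"
proof -
  let ?X = "path_image (\<gamma> {u, x})" and ?Y = "path_image (\<gamma> {w, y})"
  let ?R = "region U \<union> ?X \<union> ?Y"
  have ends: "p u \<in> ?X" "p x \<in> ?X" "p w \<in> ?Y" "p y \<in> ?Y"
    using edge_ends x y by auto
  have "p u \<in> region U" "p w \<in> region U" using x y by (auto simp: region_def)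
  then have "path_connected ?R"
    using path_connected_region[OF U] path_connected_edge x(3) y(3) ends
    by (intro path_connected_Un) auto
  moreover have "p x \<in> ?R" "p y \<in> ?R" using ends by auto
  ultimately obtain g where g: "path g" "path_image g \<subseteq> ?R" "pathstart g = p x" "pathfinish g = p y"
    unfolding path_connected_def by meson
  have "p x \<noteq> p y" using inj_p sub x y \<open>x \<noteq> y\<close> by (auto simp: inj_on_def)
  \<comment> \<open>The path may cross itself, so an arc with the same ends is extracted from
    it.\<close>
  then obtain h where h: "arc h" "path_image h \<subseteq> path_image g" "pathstart h = p x" "pathfinish h = p y"
    using path_contains_arc[OF g(1,3,4)] by metis
  have XY: "{u, x} \<in> edges_in E (U \<union> W)" "{w, y} \<in> edges_in E (U \<union> W)"
    using x y by (auto simp: edges_in_def)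
  have "?R \<subseteq> region (U \<union> W)"
    using region_mono[of U "U \<union> W"] XY by (auto simp: region_def)
  moreover have "?R \<inter> region W \<subseteq> {p x, p y}"
    using disjoint_regions[OF sub] edge_region[OF x(3) sub(2)] edge_region[OF y(3) sub(2)]
      x(1,2) y(1,2) sub(3) by blast
  ultimately show ?thesis using that[OF h(1,3,4)] h(2) g(2) by blast
qed

text \<open>\<open>realizes M S\<close>: the drawing of the subgraph induced by \<open>S\<close> contains a plane subdivision of the
  graph on \<open>{..<6}\<close> whose edges are the pairs in \<open>M\<close>.\<close>

definition realizes :: "(nat \<times> nat) set \<Rightarrow> 'v set \<Rightarrow> bool" where
  "realizes M S \<longleftrightarrow> (\<exists>v g. inj_on v {..<6} \<and> v ` {..<6} \<subseteq> p ` S \<and>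
    (\<forall>m\<in>M. arc (g m) \<and> pathstart (g m) = v (fst m) \<and> pathfinish (g m) = v (snd m) \<and>
      path_image (g m) \<subseteq> region S \<and> path_image (g m) \<inter> v ` {..<6} \<subseteq> {v (fst m), v (snd m)}) \<and>
    (\<forall>m\<in>M. \<forall>m'\<in>M. m \<noteq> m' \<longrightarrow>
      path_image (g m) \<inter> path_image (g m') \<subseteq> {v (fst m), v (snd m)} \<inter> {v (fst m'), v (snd m')}))"

text \<open>The factor \<open>33 > 2\<^sup>5\<close> forces \<open>S\<close> to have at least six vertices.\<close>

lemma dense_realizes:
  assumes "finite M" "M \<subseteq> {(i, j). i < 6 \<and> j < 6 \<and> i \<noteq> j}" "S \<subseteq> V" "S \<noteq> {}"
    and "2 ^ card M * 33 * card S \<le> card (edges_in E S)"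
  shows "realizes M S"
  using assms
proof (induction M arbitrary: S rule: finite_induct)
  case empty
  have fin: "finite S" using empty finite_V finite_subset by blast
  have "6 \<le> card S"
  proof (rule ccontr)
    assume "\<not> 6 \<le> card S"
    then have "(2::nat) ^ card S \<le> 2 ^ 5" by (intro power_increasing) auto
    moreover have "card (edges_in E S) \<le> 2 ^ card S"
      unfolding card_Pow[OF fin, symmetric]
      by (intro card_mono) (use fin in \<open>auto simp: edges_in_def\<close>)
    moreover have "1 \<le> card S" using fin empty by (simp add: Suc_le_eq card_gt_0_iff)
    ultimately show False using empty by simp
  qed
  moreover have "card (p ` S) = card S"
    using inj_p empty by (intro card_image) (auto intro: inj_on_subset)
  ultimately obtain v where "inj_on v {..<6::nat}" "v ` {..<6} \<subseteq> p ` S"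
    using card_le_inj[of "{..<6::nat}" "p ` S"] fin by auto
  then show ?case unfolding realizes_def by auto
next
  case (insert m M)
  \<comment> \<open>The hypothesis reserves one factor of two for each pair in \<open>M\<close>; the
    one for \<open>m\<close> is spent on passing from \<open>S\<close> to \<open>W\<close>.\<close>
  define L :: nat where "L = 2 * (2 ^ card M * 33)"
  have fin: "finite S" using insert.prems finite_V finite_subset by blast
  have "L * card S \<le> card (edges_in E S)" using insert by (simp add: L_def)
  moreover have "0 < L" by (simp add: L_def)
  ultimately obtain U W where UW: "connected_verts E U" "U \<subseteq> S" "W \<subseteq> S" "U \<inter> W = {}" "W \<noteq> {}"
    "\<And>w. w \<in> W \<Longrightarrow> \<exists>u\<in>U. {u, w} \<in> E" "\<And>w. w \<in> W \<Longrightarrow> L \<le> card (nbrs E W w)"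
    using dense_neighbourhood_of_connected[OF card_edge fin insert.prems(3)] by metis
  have WV: "W \<subseteq> V" "U \<subseteq> V" using UW insert.prems by auto
  have "2 ^ card M * 33 * card W \<le> card (edges_in E W)"
    using UW(3,7) fin finite_subset unfolding L_def by (intro min_degree_edges[OF card_edge]) auto
  then have "realizes M W"
    using insert.IH[of W] insert.prems WV UW by auto
  then obtain v g where inj: "inj_on v {..<6}" and vW: "v ` {..<6} \<subseteq> p ` W" and
    g: "\<And>m. m \<in> M \<Longrightarrow> arc (g m) \<and> pathstart (g m) = v (fst m) \<and> pathfinish (g m) = v (snd m) \<and>
      path_image (g m) \<subseteq> region W \<and> path_image (g m) \<inter> v ` {..<6} \<subseteq> {v (fst m), v (snd m)}" and
    gg: "\<And>m m'. m \<in> M \<Longrightarrow> m' \<in> M \<Longrightarrow> m \<noteq> m' \<Longrightarrow>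
      path_image (g m) \<inter> path_image (g m') \<subseteq> {v (fst m), v (snd m)} \<inter> {v (fst m'), v (snd m')}"
    unfolding realizes_def by metis
  have m: "fst m < 6" "snd m < 6" "fst m \<noteq> snd m" using insert.prems by auto
  have "v (fst m) \<in> p ` W" "v (snd m) \<in> p ` W" using vW m by auto
  then obtain x y where xy: "x \<in> W" "v (fst m) = p x" "y \<in> W" "v (snd m) = p y"
    by blast
  have "v (fst m) \<noteq> v (snd m)" using inj m by (auto simp: inj_on_def)
  then have "x \<noteq> y" using xy by auto
  \<comment> \<open>The arcs for \<open>M\<close> already lie in \<open>region W\<close>, and both
    ends of \<open>m\<close> have neighbours in \<open>U\<close>, so the new arc can make its detour
    through \<open>U\<close>.\<close>
  obtain a b where "a \<in> U" "{a, x} \<in> E" "b \<in> U" "{b, y} \<in> E" using UW(6) xy by meson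
  then obtain h where h: "arc h" "pathstart h = p x" "pathfinish h = p y"
    "path_image h \<subseteq> region (U \<union> W)" "path_image h \<inter> region W \<subseteq> {p x, p y}"
    using arc_through_connected[OF UW(1) WV(2,1) UW(4)] xy \<open>x \<noteq> y\<close> by metis
  have sub: "region W \<subseteq> region S" "region (U \<union> W) \<subseteq> region S"
    using UW by (auto intro!: region_mono)
  have vR: "v ` {..<6} \<subseteq> region W" using vW by (auto simp: region_def)
  have hv: "path_image h \<inter> v ` {..<6} \<subseteq> {v (fst m), v (snd m)}"
    using h(5) vR xy by auto
  \<comment> \<open>A common point lies in \<open>region W\<close>, so it is an end of
    \<open>h\<close>. That is a branch vertex, and on \<open>g k\<close> only the ends are branch
    vertices.\<close>
  have hg: "path_image h \<inter> path_image (g k) \<subseteq> {v (fst m), v (snd m)} \<inter> {v (fst k), v (snd k)}"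
    if "k \<in> M" for k
  proof -
    have "path_image h \<inter> path_image (g k) \<subseteq> {v (fst m), v (snd m)}"
      using g[OF that] h(5) xy by auto
    moreover have "{v (fst m), v (snd m)} \<subseteq> v ` {..<6}" using m by auto
    ultimately show ?thesis using g[OF that] by blast
  qed
  show ?case
    unfolding realizes_def
  proof (intro exI[of _ v] exI[of _ "g(m := h)"] conjI ballI impI)
    show "v ` {..<6} \<subseteq> p ` S" using vW UW by blast
    fix k assume k: "k \<in> insert m M"
    show "arc ((g(m := h)) k)" "pathstart ((g(m := h)) k) = v (fst k)"
      "pathfinish ((g(m := h)) k) = v (snd k)"
      "path_image ((g(m := h)) k) \<subseteq> region S"
      "path_image ((g(m := h)) k) \<inter> v ` {..<6} \<subseteq> {v (fst k), v (snd k)}"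
      using k g[of k] h xy sub hv insert.hyps by (cases "k = m"; auto)+
    fix l assume l: "l \<in> insert m M" "k \<noteq> l"
    show "path_image ((g(m := h)) k) \<inter> path_image ((g(m := h)) l)
      \<subseteq> {v (fst k), v (snd k)} \<inter> {v (fst l), v (snd l)}"
      using k l gg[of k l] hg[of k] hg[of l] by (cases "k = m"; cases "l = m") (simp_all, blast+)
  qed (use inj in auto)
qed

section \<open>Bounded degeneracy of plane graphs\<close>

lemma not_dense:
  assumes "S \<subseteq> V" "S \<noteq> {}"
  shows "card (edges_in E S) < 2 ^ 9 * 33 * card S"
proof (rule ccontr)
  assume "\<not> card (edges_in E S) < 2 ^ 9 * 33 * card S"
  \<comment> \<open>The nine edges of the complete bipartite graph with three vertices on each side;
    hence the exponent 9.\<close>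
  moreover define M where "M = {0, 1, 2::nat} \<times> {3, 4, 5::nat}"
  moreover have "card M = 9" by (simp add: M_def)
  ultimately have "realizes M S" using assms by (intro dense_realizes) auto
  then obtain v g where inj: "inj_on v {..<6}" and
    g: "\<And>m. m \<in> M \<Longrightarrow> arc (g m) \<and> pathstart (g m) = v (fst m) \<and> pathfinish (g m) = v (snd m) \<and>
      path_image (g m) \<subseteq> region S \<and> path_image (g m) \<inter> v ` {..<6} \<subseteq> {v (fst m), v (snd m)}" and
    gg: "\<And>m m'. m \<in> M \<Longrightarrow> m' \<in> M \<Longrightarrow> m \<noteq> m' \<Longrightarrow>
      path_image (g m) \<inter> path_image (g m') \<subseteq> {v (fst m), v (snd m)} \<inter> {v (fst m'), v (snd m')}"
    unfolding realizes_def by metis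
  show False
  proof (rule no_K33_arcs[OF inj])
    fix i j :: nat assume "i \<in> {0, 1, 2}" "j \<in> {3, 4, 5}"
    then have ij: "(i, j) \<in> M" by (auto simp: M_def)
    show "arc (g (i, j)) \<and> pathstart (g (i, j)) = v i \<and> pathfinish (g (i, j)) = v j \<and>
        path_image (g (i, j)) \<inter> v ` {..<6} \<subseteq> {v i, v j}"
      using g[OF ij] by simp
    fix k l :: nat assume "k \<in> {0, 1, 2}" "l \<in> {3, 4, 5}" and ne: "(i, j) \<noteq> (k, l)"
    then have "(k, l) \<in> M" by (auto simp: M_def)
    then show "path_image (g (i, j)) \<inter> path_image (g (k, l)) \<subseteq> {v i, v j} \<inter> {v k, v l}"
      using gg[OF ij _ ne] by simp
  qed
qed

text \<open>If all degrees were at least \<open>2 ^ 10 * 33\<close>, there would be at least half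
  that many edges per vertex.\<close>

lemma low_degree_vertex:
  assumes "S \<subseteq> V" "S \<noteq> {}"
  shows "\<exists>x\<in>S. card (nbrs E S x) < 2 ^ 10 * 33"
proof (rule ccontr)
  assume "\<not> ?thesis"
  then have "2 ^ 9 * 33 * card S \<le> card (edges_in E S)"
    using finite_subset[OF assms(1) finite_V] by (intro min_degree_edges[OF card_edge]) force+
  then show False using not_dense[OF assms] by simp
qed

end

lemma planar_degenerate:
  assumes "simple_graph G" "planar G" "S \<subseteq> verts G" "S \<noteq> {}"
  shows "\<exists>x\<in>S. card (nbrs (edges G) S x) < 2 ^ 10 * 33"
proof -
  obtain p \<gamma> where "plane_drawing G p \<gamma>" using assms by (auto simp: planar_def)
  then interpret drawn_graph "verts G" "edges G" p \<gamma>
    using assms by unfold_locales auto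
  show ?thesis using low_degree_vertex assms by simp
qed

section \<open>Counting embeddings\<close>

text \<open>Extensional maps, so that each embedding is represented by one function and finite
  graphs have finitely many.\<close>

definition embeddings :: "'a graph \<Rightarrow> 'v graph \<Rightarrow> ('a \<Rightarrow> 'v) set" where
  "embeddings H G = {f \<in> verts H \<rightarrow>\<^sub>E verts G. inj_on f (verts H) \<and> (\<forall>e\<in>edges H. f ` e \<in> edges G)}"

lemma finite_embeddings:
  "finite (verts H) \<Longrightarrow> finite (verts G) \<Longrightarrow> finite (embeddings H G)"
  by (rule finite_subset[OF _ finite_PiE[of "verts H" "\<lambda>_. verts G"]]) (auto simp: embeddings_def)

text \<open>An isomorphism onto a copy, restricted to the vertices of \<open>H\<close>, is an
  embedding whose image is that copy.\<close>

lemma card_copies_le_embeddings: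
  assumes H: "simple_graph H" and G: "finite (verts G)"
  shows "card (copies H G) \<le> card (embeddings H G)"
proof (rule surj_card_le)
  show "finite (embeddings H G)"
    using H G by (intro finite_embeddings) (auto simp: simple_graph_def)
  show "copies H G \<subseteq> (\<lambda>f. (f ` verts H, (\<lambda>e. f ` e) ` edges H)) ` embeddings H G"
  proof
    fix F assume F: "F \<in> copies H G"
    then obtain f where f: "bij_betw f (verts H) (verts F)" "(\<lambda>e. f ` e) ` edges H = edges F"
      by (auto simp: copies_def isomorphic_def)
    have sub: "verts F \<subseteq> verts G" "edges F \<subseteq> edges G"
      using F by (auto simp: copies_def subgraph_def)
    define f' where "f' = restrict f (verts H)"
    have "f' ` e = f ` e" if "e \<subseteq> verts H" for e
      unfolding f'_def using that by (intro image_cong) auto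
    moreover have "e \<subseteq> verts H" if "e \<in> edges H" for e
      using H that by (auto simp: simple_graph_def)
    ultimately have im: "f' ` verts H = verts F" "\<And>e. e \<in> edges H \<Longrightarrow> f' ` e = f ` e"
      using f(1) by (auto simp: bij_betw_def)
    have "f' \<in> embeddings H G"
      using f sub im unfolding embeddings_def f'_def
      by (auto simp: bij_betw_def inj_on_restrict_eq)
    moreover have "(\<lambda>e. f' ` e) ` edges H = edges F"
      unfolding f(2)[symmetric] by (rule image_cong[OF refl im(2)])
    ultimately show "F \<in> (\<lambda>f. (f ` verts H, (\<lambda>e. f ` e) ` edges H)) ` embeddings H G"
      using im(1) by (intro image_eqI[of _ _ f']) (auto simp: prod_eq_iff)
  qed
qed

lemma independent_set_card_le:
  assumes "finite (verts H)" "independent_set H S"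
  shows "card S \<le> independence_number H"
  unfolding independence_number_def
proof (rule Max_ge)
  have "{S. independent_set H S} \<subseteq> Pow (verts H)" by (auto simp: independent_set_def)
  then show "finite (card ` {S. independent_set H S})"
    using assms(1) by (meson finite_Pow_iff finite_imageI finite_subset)
qed (use assms in auto)

text \<open>Numbers below \<open>D\<close> serve as names of elements; in the counting they encode
  the choice of a lower neighbour.\<close>

lemma finite_enumeration:
  assumes "finite A" "card A < D"
  shows "\<exists>f :: nat \<Rightarrow> 'v. A \<subseteq> f ` {..<D}"
proof -
  obtain f where "bij_betw f {0..<card A} A"
    using ex_bij_betw_nat_finite[OF assms(1)] by blast
  then have "A = f ` {0..<card A}" by (simp add: bij_betw_def)
  also have "\<dots> \<subseteq> f ` {..<D}" using assms(2) by (intro image_mono) auto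
  finally show ?thesis by blast
qed

text \<open>An embedding \<open>f\<close> orients each edge of \<open>H\<close> upwards in the ranking \<open>r\<close> of \<open>G\<close>. The vertices
  without an outgoing edge are independent; every other vertex \<open>u\<close> has an upper neighbour \<open>\<pi> u\<close>, and
  \<open>f u\<close> is one of fewer than \<open>D\<close> lower neighbours of \<open>f (\<pi> u)\<close>. Hence \<open>f\<close> is determined by
  \<open>\<pi>\<close>, the numbers \<open>k u\<close> of these neighbours, and its values on the fixed points of \<open>\<pi>\<close>.\<close>

lemma card_embeddings_le:
  fixes H :: "'a graph" and G :: "'v graph" and r :: "'v \<Rightarrow> nat"
  assumes H: "simple_graph H" and G: "finite (verts G)" "verts G \<noteq> {}"
    and r: "inj_on r (verts G)" "r ` verts G \<subseteq> {..<B}"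
    and deg: "\<forall>v\<in>verts G. card {u \<in> verts G. {u, v} \<in> edges G \<and> r u < r v} < D"
  shows "card (embeddings H G) \<le>
    card (verts H) ^ card (verts H) * D ^ card (verts H) * card (verts G) ^ independence_number H"
proof -
  let ?V = "verts H" and ?W = "verts G"
  have finV: "finite ?V" using H by (auto simp: simple_graph_def)
  have "\<forall>v\<in>?W. \<exists>f :: nat \<Rightarrow> 'v. {u \<in> ?W. {u, v} \<in> edges G \<and> r u < r v} \<subseteq> f ` {..<D}"
    using deg G(1) by (intro ballI finite_enumeration) auto
  from bchoice[OF this] obtain nb where
    nb: "\<And>v. v \<in> ?W \<Longrightarrow> {u \<in> ?W. {u, v} \<in> edges G \<and> r u < r v} \<subseteq> nb v ` {..<D}"
    by blast
  have D: "0 < D" using deg G(2) by fastforce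
  define X where "X = (?V \<rightarrow>\<^sub>E ?V) \<times> (?V \<rightarrow>\<^sub>E {..<D})"
  define fixp where "fixp \<pi> = {u \<in> ?V. \<pi> u = u}" for \<pi>
  define A where "A = (\<lambda>(\<pi>, k). {f \<in> embeddings H G. independent_set H (fixp \<pi>) \<and>
    (\<forall>u\<in>?V. \<pi> u \<noteq> u \<longrightarrow> r (f u) < r (f (\<pi> u)) \<and> f u = nb (f (\<pi> u)) (k u))})"
  have cover: "embeddings H G \<subseteq> (\<Union>x\<in>X. A x)"
  proof
    fix f assume f: "f \<in> embeddings H G"
    then have fV: "\<And>u. u \<in> ?V \<Longrightarrow> f u \<in> ?W" and injf: "inj_on f ?V"
      and fe: "\<And>e. e \<in> edges H \<Longrightarrow> f ` e \<in> edges G"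
      by (auto simp: embeddings_def)
    define up where "up u w \<longleftrightarrow> w \<in> ?V \<and> {u, w} \<in> edges H \<and> r (f u) < r (f w)" for u w
    define \<pi> where "\<pi> = restrict (\<lambda>u. if \<exists>w. up u w then SOME w. up u w else u) ?V"
    \<comment> \<open>Where no number works, the default is 0, which lies below \<open>D\<close>
      because \<open>D\<close> is positive.\<close>
    define k where "k = restrict (\<lambda>u. if \<exists>i. i < D \<and> f u = nb (f (\<pi> u)) i
      then SOME i. i < D \<and> f u = nb (f (\<pi> u)) i else 0) ?V"
    have up: "up u (\<pi> u)" if "u \<in> ?V" "\<exists>w. up u w" for u
      using someI_ex[OF that(2)] that by (simp add: \<pi>_def)
    \<comment> \<open>The strict increase of rank excludes \<open>up u u\<close>, so the fixed
      points are exactly the vertices without an upper neighbour.\<close>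
    have fixp: "\<pi> u = u \<longleftrightarrow> (\<nexists>w. up u w)" if "u \<in> ?V" for u
    proof
      show "\<nexists>w. up u w" if "\<pi> u = u"
        using up[OF \<open>u \<in> ?V\<close>] that unfolding up_def by fastforce
      show "\<pi> u = u" if "\<nexists>w. up u w"
        using that \<open>u \<in> ?V\<close> by (auto simp: \<pi>_def)
    qed
    have k: "k u < D \<and> f u = nb (f (\<pi> u)) (k u)" if "u \<in> ?V" "\<exists>i. i < D \<and> f u = nb (f (\<pi> u)) i" for u
      using someI_ex[OF that(2)] that by (simp add: k_def)
    have "\<pi> u \<in> ?V" if "u \<in> ?V" for u
    proof (cases "\<exists>w. up u w")
      case True
      then show ?thesis using up[OF that] by (simp add: up_def)
    next
      case False
      then show ?thesis using fixp[OF that] that by simp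
    qed
    then have "\<pi> \<in> ?V \<rightarrow>\<^sub>E ?V" by (auto simp: \<pi>_def)
    moreover have "k u < D" if "u \<in> ?V" for u
    proof (cases "\<exists>i. i < D \<and> f u = nb (f (\<pi> u)) i")
      case True
      then show ?thesis using k[OF that] by blast
    next
      case False
      then have "k u = 0" using that by (auto simp: k_def)
      then show ?thesis using D by simp
    qed
    then have "k \<in> ?V \<rightarrow>\<^sub>E {..<D}" by (auto simp: k_def)
    moreover have "independent_set H (fixp \<pi>)"
      unfolding independent_set_def
    proof (intro conjI ballI notI)
      fix e assume e: "e \<in> edges H" "e \<subseteq> fixp \<pi>"
      then have "card e = 2" using H by (auto simp: simple_graph_def)
      then obtain a b where ab: "e = {a, b}" "a \<noteq> b" by (auto simp: card_2_iff)
      then have V: "a \<in> ?V" "b \<in> ?V" and fx: "\<pi> a = a" "\<pi> b = b"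
        using e by (auto simp: fixp_def)
      \<comment> \<open>Since \<open>f\<close> and \<open>r\<close> are injective, one end of the
        edge is ranked below the other and so cannot be a fixed point.\<close>
      have "r (f a) \<noteq> r (f b)"
        using V ab(2) injf r(1) fV by (meson inj_onD)
      then have "up a b \<or> up b a"
        using e(1) ab(1) V by (auto simp: up_def insert_commute)
      then show False using fixp V fx by blast
    qed (auto simp: fixp_def)
    moreover have "r (f u) < r (f (\<pi> u)) \<and> f u = nb (f (\<pi> u)) (k u)"
      if u: "u \<in> ?V" "\<pi> u \<noteq> u" for u
    proof -
      have "up u (\<pi> u)" using up fixp u by blast
      then have *: "\<pi> u \<in> ?V" "{u, \<pi> u} \<in> edges H" "r (f u) < r (f (\<pi> u))"
        by (auto simp: up_def)
      then have "f u \<in> nb (f (\<pi> u)) ` {..<D}"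
        using nb[of "f (\<pi> u)"] fV u(1) fe[OF *(2)] by auto
      then have "\<exists>i. i < D \<and> f u = nb (f (\<pi> u)) i" by auto
      then have "f u = nb (f (\<pi> u)) (k u)" using k[OF u(1)] by blast
      then show ?thesis using * by blast
    qed
    ultimately have "(\<pi>, k) \<in> X" "f \<in> A (\<pi>, k)"
      unfolding X_def A_def prod.case using f by blast+
    then show "f \<in> (\<Union>x\<in>X. A x)" by blast
  qed
  have bound: "card (A x) \<le> card ?W ^ independence_number H" for x
  proof (cases "A x = {}")
    case False
    obtain \<pi> k where x: "x = (\<pi>, k)" by fastforce
    have ind: "independent_set H (fixp \<pi>)" using False by (auto simp: A_def x)
    have finF: "finite (fixp \<pi>)" using finV by (simp add: fixp_def)
    have "card (A x) \<le> card (fixp \<pi> \<rightarrow>\<^sub>E ?W)"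
    proof (rule card_inj_on_le)
      show "(\<lambda>f. restrict f (fixp \<pi>)) ` A x \<subseteq> fixp \<pi> \<rightarrow>\<^sub>E ?W"
        by (auto simp: A_def x embeddings_def fixp_def split: if_splits)
      show "inj_on (\<lambda>f. restrict f (fixp \<pi>)) (A x)"
      proof (rule inj_onI)
        fix f g assume f: "f \<in> A x" and g: "g \<in> A x"
          and eq: "restrict f (fixp \<pi>) = restrict g (fixp \<pi>)"
        have fE: "f \<in> ?V \<rightarrow>\<^sub>E ?W" and gE: "g \<in> ?V \<rightarrow>\<^sub>E ?W"
          using f g by (auto simp: A_def x embeddings_def)
        have "f u = g u" if "u \<in> ?V" for u
          using that
        \<comment> \<open>Induction from the highest rank downwards: away from its fixed points
          \<open>\<pi>\<close> raises the rank of the image, and ranks stay below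
          \<open>B\<close>.\<close>
        proof (induction "B - r (f u)" arbitrary: u rule: less_induct)
          case less
          show ?case
          proof (cases "\<pi> u = u")
            case True
            then have "u \<in> fixp \<pi>" using less by (simp add: fixp_def)
            then show ?thesis using fun_cong[OF eq, of u] by simp
          next
            case False
            then have f': "r (f u) < r (f (\<pi> u))" "f u = nb (f (\<pi> u)) (k u)"
              and g': "g u = nb (g (\<pi> u)) (k u)"
              using f g less.prems by (auto simp: A_def x)
            show ?thesis
            proof (cases "\<pi> u \<in> ?V")
              case True
              then have "r (f (\<pi> u)) < B" using r(2) fE by blast
              then have "f (\<pi> u) = g (\<pi> u)" using less.hyps[OF _ True] f'(1) by simp
              then show ?thesis using f' g' by simp
            next
              \<comment> \<open>The bound is claimed for every \<open>x\<close>, so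
                \<open>\<pi> u\<close> may lie outside \<open>H\<close>; there both extensional maps
                take the same default value.\<close>
              case False
              then show ?thesis using f'(2) g' fE gE by (simp add: PiE_def extensional_def)
            qed
          qed
        qed
        then show "f = g" using fE gE by (rule PiE_ext[rotated -1])
      qed
    qed (use finF G in \<open>auto intro: finite_PiE\<close>)
    also have "\<dots> = card ?W ^ card (fixp \<pi>)" by (rule card_funcsetE[OF finF])
    also have "\<dots> \<le> card ?W ^ independence_number H"
      using independent_set_card_le[OF finV ind] G
      by (intro power_increasing) (auto simp: Suc_le_eq card_gt_0_iff)
    finally show ?thesis .
  qed simp
  have finX: "finite X" using finV by (auto simp: X_def intro!: finite_PiE)
  have "finite (A x)" for x
    using finite_embeddings[OF finV G(1)] by (cases x) (auto simp: A_def)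
  then have "card (embeddings H G) \<le> card (\<Union>x\<in>X. A x)"
    using cover finX by (intro card_mono) auto
  also have "\<dots> \<le> (\<Sum>x\<in>X. card (A x))" by (rule card_UN_le[OF finX])
  also have "\<dots> \<le> card X * card ?W ^ independence_number H"
    using sum_bounded_above[of X "\<lambda>x. card (A x)"] bound by simp
  also have "card X = card ?V ^ card ?V * D ^ card ?V"
    by (simp add: X_def card_cartesian_product card_funcsetE[OF finV])
  finally show ?thesis .
qed

section \<open>From embeddings to the extremal number\<close>

lemma card_copies_planar:
  assumes H: "simple_graph H" and G: "simple_graph G" "planar G"
  shows "card (copies H G) \<le> card (verts H) ^ card (verts H) * (2 ^ 10 * 33) ^ card (verts H) *
    card (verts G) ^ independence_number H"
proof -
  have fin: "finite (verts G)" "verts G \<noteq> {}" using G by (auto simp: simple_graph_def)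
  obtain r where "inj_on r (verts G)" "r ` verts G \<subseteq> {..<card (verts G)}"
    "\<forall>v\<in>verts G. card {u \<in> verts G. {u, v} \<in> edges G \<and> r u < r v} < 2 ^ 10 * 33"
    using degeneracy_ranking[OF fin(1) planar_degenerate[OF G]] by blast
  then have "card (embeddings H G) \<le> card (verts H) ^ card (verts H) *
      (2 ^ 10 * 33) ^ card (verts H) * card (verts G) ^ independence_number H"
    by (rule card_embeddings_le[OF H fin])
  then show ?thesis using card_copies_le_embeddings[OF H fin(1)] by (rule order.trans[rotated])
qed

text \<open>The bound \<open>b\<close> makes the set under \<open>Max\<close> finite, and the
  edgeless graph on \<open>n > 0\<close> vertices makes it nonempty.\<close>

lemma ex_planar_le:
  assumes "n > 0" and "\<And>G :: nat graph. simple_graph G \<Longrightarrow> card (verts G) = n \<Longrightarrow> planar G \<Longrightarrow>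
    card (copies H G) \<le> b"
  shows "ex_planar n H \<le> b"
proof -
  let ?X = "{card (copies H G) | G :: nat graph. simple_graph G \<and> card (verts G) = n \<and> planar G}"
  have sub: "?X \<subseteq> {..b}" using assms(2) by auto
  define G :: "nat graph" where "G = ({..<n}, {})"
  \<comment> \<open>Without edges, distinct positions for the vertices are all that a drawing
    requires.\<close>
  have "plane_drawing G of_nat g" for g by (simp add: plane_drawing_def G_def)
  then have "planar G" unfolding planar_def by blast
  moreover have "simple_graph G" "card (verts G) = n"
    using assms(1) by (auto simp: simple_graph_def G_def)
  ultimately have "?X \<noteq> {}" by blast
  moreover have "finite ?X" using sub finite_subset by blast
  ultimately show ?thesis unfolding ex_planar_def using sub by (intro Max.boundedI) auto
qed

theorem theorem2p4:
  fixes H :: "'a graph"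
  assumes "simple_graph H"
  shows "(\<lambda>n. real (ex_planar n H)) \<in> O(\<lambda>n. real n ^ independence_number H)"
proof -
  define c where "c = card (verts H) ^ card (verts H) * (2 ^ 10 * 33) ^ card (verts H)"
  have "ex_planar n H \<le> c * n ^ independence_number H" if "n > 0" for n
    using that card_copies_planar[OF assms] unfolding c_def by (intro ex_planar_le) auto
  then have "real (ex_planar n H) \<le> real c * real n ^ independence_number H" if "n > 0" for n
    using that by (metis of_nat_le_iff of_nat_mult of_nat_power)
  \<comment> \<open>The case \<open>n = 0\<close>, where \<open>ex_planar\<close> is unspecified,
    does not affect the asymptotic statement.\<close>
  then show ?thesis
    by (intro bigoI[where c = "real c"] eventually_mono[OF eventually_gt_at_top[of 0]]) auto
qed

end
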